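(* Let $X$ be a minimal shift space on a finite alphabet $A$ and $\varphi\colon A^*\to G$ a (monoid) morphism onto a finite group $G$. The following conditions are equivalent: (i) $\varphi$ has a cobounding map mod $1$ on $X$ (that is, modulo the trivial subgroup). (ii) $\varphi(\mathcal R_X(u))=\{1_G\}$ for every long enough $u\in\mathcal L(X)$. (iii) $\varphi(\mathcal R_X(u))=\{1_G\}$ for some word $u\in\mathcal L(X)$.
   Context: A shift space on a finite alphabet $A$ is a nonempty closed subset $X\subseteq A^{\mathbb Z}$ invariant under the shift map $S((x_n)_n)=(x_{n+1})_n$, such that every letter of $A$ occurs in some element of $X$; it is minimal if it has no proper nonempty closed shift-invariant subset. The language $\mathcal L(X)$ is the set of all finite words $x_ix_{i+1}\cdots x_{j-1}$ with $x\in X$, $i\le j$. For $u\in\mathcal L(X)$, the set $\mathcal R_X(u)$ of return words to $u$ is the set of nonempty words $r\in A^*$ such that $ru\in\mathcal L(X)$ and $ru$ has exactly two occurrences of $u$ as a factor, one as a prefix and one as a suffix. A cobounding map for $\varphi$ on $X$ modulo the trivial subgroup is a continuous map $\alpha\colon X\to G$ ($G$ discrete) with $\alpha(Sx)=\alpha(x)\varphi(x_0)$ for all $x\in X$. *)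

theory Defs
  imports "HOL-Analysis.Analysis" "HOL-Algebra.Group" "HOL-Library.Sublist"
begin

definition full_shift :: "'a set \<Rightarrow> (int \<Rightarrow> 'a) topology" where
  "full_shift A = product_topology (\<lambda>_. discrete_topology A) UNIV"

definition shift :: "(int \<Rightarrow> 'a) \<Rightarrow> (int \<Rightarrow> 'a)" where
  "shift x = (\<lambda>n. x (n + 1))"

text \<open>Invariance of a set of two-sided sequences is read as \<open>S(X) = X\<close>, both for shift
  spaces and for the subsets quantified over in minimality.\<close>

definition shift_space :: "'a set \<Rightarrow> (int \<Rightarrow> 'a) set \<Rightarrow> bool" where
  "shift_space A X \<longleftrightarrow>
     X \<noteq> {} \<and> closedin (full_shift A) X \<and> shift ` X = X \<and>
     (\<forall>a\<in>A. \<exists>x\<in>X. \<exists>n. x n = a)"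

definition minimal_shift_space :: "'a set \<Rightarrow> (int \<Rightarrow> 'a) set \<Rightarrow> bool" where
  "minimal_shift_space A X \<longleftrightarrow>
     shift_space A X \<and>
     \<not> (\<exists>Y. Y \<subset> X \<and> Y \<noteq> {} \<and> closedin (full_shift A) Y \<and> shift ` Y = Y)"

definition language :: "(int \<Rightarrow> 'a) set \<Rightarrow> 'a list set" where
  "language X = {map x [i..j - 1] | x i j. x \<in> X \<and> i \<le> j}"

definition occurrences :: "'a list \<Rightarrow> 'a list \<Rightarrow> nat set" where
  "occurrences u w = {i. i + length u \<le> length w \<and> take (length u) (drop i w) = u}"

text \<open>For \<open>X \<subseteq> A\<^sup>\<int>\<close> the requirement \<open>r \<in> A\<^sup>*\<close> is implied by \<open>ru \<in> language X\<close>.\<close>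

definition return_words :: "(int \<Rightarrow> 'a) set \<Rightarrow> 'a list \<Rightarrow> 'a list set" where
  "return_words X u =
     {r. r \<noteq> [] \<and> r @ u \<in> language X \<and>
         card (occurrences u (r @ u)) = 2 \<and> prefix u (r @ u) \<and> suffix u (r @ u)}"

definition word_monoid :: "'a set \<Rightarrow> 'a list monoid" where
  "word_monoid A = \<lparr>carrier = lists A, mult = (@), one = []\<rparr>"

text \<open>Elements of \<open>hom\<close> are only required to preserve products; when the codomain is a group
  they also preserve the unit, so they are the monoid morphisms.\<close>

lemma hom_word_monoid_Nil:
  assumes "group G" "\<phi> \<in> hom (word_monoid A) G"
  shows "\<phi> [] = \<one>\<^bsub>G\<^esub>"
proof -
  interpret group G by fact
  have "\<phi> [] \<in> carrier G"
    using assms(2) by (auto simp: hom_def word_monoid_def)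
  moreover have "\<phi> ([] @ []) = \<phi> [] \<otimes>\<^bsub>G\<^esub> \<phi> []"
    using hom_mult[OF assms(2), of "[]" "[]"] by (simp add: word_monoid_def)
  ultimately show ?thesis by simp
qed

text \<open>Cobounding maps modulo the trivial subgroup.\<close>

definition cobounding_map ::
  "'a set \<Rightarrow> (int \<Rightarrow> 'a) set \<Rightarrow> ('g, 'm) monoid_scheme \<Rightarrow> ('a list \<Rightarrow> 'g) \<Rightarrow>
   ((int \<Rightarrow> 'a) \<Rightarrow> 'g) \<Rightarrow> bool" where
  "cobounding_map A X G \<phi> \<alpha> \<longleftrightarrow>
     continuous_map (subtopology (full_shift A) X) (discrete_topology (carrier G)) \<alpha> \<and>
     (\<forall>x\<in>X. \<alpha> (shift x) = \<alpha> x \<otimes>\<^bsub>G\<^esub> \<phi> [x 0])"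

end

theory Submission
  imports Defs
begin

text \<open>
  A cobounding map \<open>\<alpha>\<close> is locally constant on a compact space, hence \<open>\<alpha> x\<close> is determined by a window
  of \<open>x\<close> of some fixed radius \<open>n\<close>. If \<open>u\<close> is longer than the window and \<open>r\<close> is a return word to \<open>u\<close>
  read in \<open>x\<close> at position \<open>0\<close>, then the windows at positions \<open>n\<close> and \<open>n + |r|\<close> coincide; comparing
  the values of \<open>\<alpha>\<close> there and cancelling gives \<open>\<phi> r = 1\<close>.

  Conversely, if \<open>\<phi>\<close> is trivial on the return words to \<open>u\<close>, let \<open>p x\<close> be the word read in \<open>x\<close> from
  position \<open>0\<close> to the first occurrence of \<open>u\<close> (which exists by minimality and compactness). Then
  \<open>x \<mapsto> (\<phi> (p x))\<^sup>-\<^sup>1\<close> is a cobounding map: shifting \<open>x\<close> removes the first letter of \<open>p x\<close>, except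
  when \<open>p x\<close> is empty, and then the next occurrence of \<open>u\<close> closes a return word.
\<close>

section \<open>Factors of two-sided sequences\<close>

text \<open>An integer start with a natural length needs no side condition such as i \<le> j, so
  \<open>factor_add\<close> and induction on the length hold unconditionally.\<close>

definition factor :: "(int \<Rightarrow> 'a) \<Rightarrow> int \<Rightarrow> nat \<Rightarrow> 'a list" where
  "factor x i n = map (\<lambda>k. x (i + int k)) [0..<n]"

lemma length_factor [simp]: "length (factor x i n) = n"
  by (simp add: factor_def)

lemma nth_factor [simp]: "k < n \<Longrightarrow> factor x i n ! k = x (i + int k)"
  by (simp add: factor_def)

lemma factor_0 [simp]: "factor x i 0 = []"
  by (simp add: factor_def)

lemma factor_add: "factor x i (m + n) = factor x i m @ factor x (i + int m) n"
  by (rule nth_equalityI) (auto simp: nth_append algebra_simps)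

lemma factor_Suc: "factor x i (Suc n) = x i # factor x (i + 1) n"
  using factor_add[of x i 1 n] by (simp add: factor_def)

lemma factor_Suc_right: "factor x i (Suc n) = factor x i n @ [x (i + int n)]"
  by (simp add: factor_def)

lemma take_drop_factor:
  "k + m \<le> n \<Longrightarrow> take m (drop k (factor x i n)) = factor x (i + int k) m"
  by (rule nth_equalityI) (auto simp: algebra_simps)

lemma factor_eq_iff: "factor x i n = factor y j n \<longleftrightarrow> (\<forall>k<n. x (i + int k) = y (j + int k))"
  by (auto simp: list_eq_iff_nth_eq)

lemma factor_in_lists: "range x \<subseteq> A \<Longrightarrow> factor x i n \<in> lists A"
  by (auto simp: factor_def image_subset_iff)

lemma map_upto_eq_factor:
  assumes "i \<le> j" shows "map x [i..j - 1] = factor x i (nat (j - i))"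
  by (rule nth_equalityI) (use assms in auto)

lemma language_eq: "language X = {factor x i n | x i n. x \<in> X}"
proof (intro equalityI subsetI)
  fix w assume "w \<in> language X"
  then show "w \<in> {factor x i n | x i n. x \<in> X}"
    unfolding language_def using map_upto_eq_factor by blast
next
  fix w assume "w \<in> {factor x i n | x i n. x \<in> X}"
  then obtain x i n where "x \<in> X" "w = factor x i n" by blast
  then have "w = map x [i..(i + int n) - 1] \<and> x \<in> X \<and> i \<le> i + int n"
    by (simp add: map_upto_eq_factor)
  then show "w \<in> language X" unfolding language_def by blast
qed

lemma occurrences_factor:
  "occurrences u (factor x i n) =
     {k. k + length u \<le> n \<and> factor x (i + int k) (length u) = u}"
  by (auto simp: occurrences_def take_drop_factor)

text \<open>In a word of length j + |u| an occurrence of u starts at j or earlier, so the hypothesis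
  \<open>first\<close> leaves only the positions 0 and j.\<close>

lemma first_return_in_return_words:
  assumes "x \<in> X" and here: "factor x i (length u) = u"
    and "0 < j" and return: "factor x (i + int j) (length u) = u"
    and first: "\<And>k. \<lbrakk>0 < k; k < j\<rbrakk> \<Longrightarrow> factor x (i + int k) (length u) \<noteq> u"
  shows "factor x i j \<in> return_words X u"
proof -
  have eq: "factor x i j @ u = factor x i (j + length u)"
    by (simp add: factor_add return)
  have "occurrences u (factor x i (j + length u)) = {0, j}"
    unfolding occurrences_factor using here return first by (auto intro: ccontr)
  then have "card (occurrences u (factor x i j @ u)) = 2"
    using \<open>0 < j\<close> by (simp add: eq)
  \<comment> \<open>The same word is cut after |u| letters instead of after j, which works even if
    the two occurrences overlap.\<close>
  moreover have "factor x i (j + length u) = u @ factor x (i + int (length u)) j"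
    using factor_add[of x i "length u" j] by (simp add: here add.commute)
  then have "prefix u (factor x i j @ u)" by (simp add: eq)
  moreover have "factor x i j @ u \<in> language X"
    unfolding eq language_eq using \<open>x \<in> X\<close> by blast
  moreover have "factor x i j \<noteq> []"
    using \<open>0 < j\<close> length_factor[of x i j] by (metis less_irrefl list.size(3))
  ultimately show ?thesis by (simp add: return_words_def suffix_def)
qed

section \<open>Topology of shift spaces\<close>

lemma funpow_shift: "(shift ^^ n) x = (\<lambda>k. x (k + int n))"
  by (induction n) (auto simp: shift_def algebra_simps)

lemma factor_funpow_shift: "factor ((shift ^^ n) x) i m = factor x (i + int n) m"
  by (simp add: factor_def funpow_shift algebra_simps)

lemma topspace_full_shift: "topspace (full_shift A) = {x. range x \<subseteq> A}"
  by (auto simp: full_shift_def PiE_def Pi_def)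

lemma compact_space_full_shift:
  assumes "finite A" shows "compact_space (full_shift A)"
  unfolding full_shift_def
  using assms by (simp add: compact_space_product_topology compact_space_discrete_topology)

lemma openin_coordinate: "openin (full_shift A) {y. range y \<subseteq> A \<and> y k = a}"
proof -
  have "continuous_map (full_shift A) (discrete_topology A) (\<lambda>x. x k)"
    unfolding full_shift_def by (rule continuous_map_product_projection) simp
  \<comment> \<open>Intersecting with A gives an open set of the discrete space on A even if a is
    not a letter of A.\<close>
  then have "openin (full_shift A) {y \<in> topspace (full_shift A). y k \<in> {a} \<inter> A}"
    by (rule openin_continuous_map_preimage) simp
  moreover have "{y \<in> topspace (full_shift A). y k \<in> {a} \<inter> A} = {y. range y \<subseteq> A \<and> y k = a}"
    by (auto simp: topspace_full_shift)
  ultimately show ?thesis by simp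
qed

lemma openin_cylinder: "openin (full_shift A) {y. range y \<subseteq> A \<and> factor y i (length u) = u}"
proof -
  have "openin (full_shift A) {y. range y \<subseteq> A \<and> (\<forall>k<n. y (i + int k) = u ! k)}" for n
  proof (induction n)
    case 0
    then show ?case by (simp flip: topspace_full_shift)
  next
    case (Suc n)
    have "{y. range y \<subseteq> A \<and> (\<forall>k<Suc n. y (i + int k) = u ! k)} =
      {y. range y \<subseteq> A \<and> (\<forall>k<n. y (i + int k) = u ! k)} \<inter>
      {y. range y \<subseteq> A \<and> y (i + int n) = u ! n}"
      by (auto simp: less_Suc_eq)
    then show ?case using openin_Int[OF Suc openin_coordinate] by simp
  qed
  from this[of "length u"] show ?thesis by (simp add: list_eq_iff_nth_eq)
qed

text \<open>A basic open set of the product constrains finitely many coordinates, and these all lie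
  in a window of positions -n to n - 1.\<close>

lemma openin_full_shift_window:
  assumes "openin (full_shift A) U" "x \<in> U"
  obtains n where
    "\<And>y. \<lbrakk>range y \<subseteq> A; factor y (- int n) (2 * n) = factor x (- int n) (2 * n)\<rbrakk> \<Longrightarrow> y \<in> U"
proof -
  obtain V where V: "finite {i. V i \<noteq> A}" "x \<in> Pi\<^sub>E UNIV V" "Pi\<^sub>E UNIV V \<subseteq> U"
    using assms unfolding full_shift_def openin_product_topology_alt by fastforce
  obtain n :: nat where n: "\<bar>i\<bar> < int n" if "V i \<noteq> A" for i
  proof -
    have "finite ((\<lambda>i. nat \<bar>i\<bar>) ` {i. V i \<noteq> A})" using V(1) by simp
    then obtain m where m: "\<forall>k\<in>(\<lambda>i. nat \<bar>i\<bar>) ` {i. V i \<noteq> A}. k \<le> m"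
      using finite_nat_set_iff_bounded_le by blast
    \<comment> \<open>The successor makes the bound strict, as the window stops at n - 1.\<close>
    show ?thesis by (rule that[of "Suc m"]) (use m in force)
  qed
  show ?thesis
  proof (rule that[of n])
    fix y assume "range y \<subseteq> A"
      and eq: "factor y (- int n) (2 * n) = factor x (- int n) (2 * n)"
    have "y i \<in> V i" for i
    proof (cases "V i = A")
      case True
      then show ?thesis using \<open>range y \<subseteq> A\<close> by auto
    next
      case False
      then have i: "\<bar>i\<bar> < int n" by (rule n)
      then have "nat (i + int n) < 2 * n" by linarith
      then have "y (- int n + int (nat (i + int n))) = x (- int n + int (nat (i + int n)))"
        using eq unfolding factor_eq_iff by blast
      moreover have "- int n + int (nat (i + int n)) = i" using i by linarith
      ultimately have "y i = x i" by simp
      then show ?thesis using V(2) by auto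
    qed
    then show "y \<in> U" using V(3) by auto
  qed
qed

section \<open>Minimal shift spaces: recurrence of words and existence of return words\<close>

locale minimal_shift =
  fixes A :: "'a set" and X :: "(int \<Rightarrow> 'a) set"
  assumes finite_alphabet: "finite A" and minimal: "minimal_shift_space A X"
begin

lemma nonempty: "X \<noteq> {}"
  and closedin: "closedin (full_shift A) X"
  and shift_image: "shift ` X = X"
  using minimal by (auto simp: minimal_shift_space_def shift_space_def)

lemma range_subset: "x \<in> X \<Longrightarrow> range x \<subseteq> A"
  using closedin_subset[OF closedin] by (auto simp: topspace_full_shift)

lemma compactin: "compactin (full_shift A) X"
  using closedin_compact_space[OF compact_space_full_shift[OF finite_alphabet] closedin] .

lemma shift_in: "x \<in> X \<Longrightarrow> shift x \<in> X"
  using shift_image by blast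

lemma funpow_shift_in: "x \<in> X \<Longrightarrow> (shift ^^ n) x \<in> X"
  by (induction n) (auto intro: shift_in)

text \<open>Since the shift maps X onto X, points can also be moved backwards. This settles negative
  starting positions; iterating the shift settles the others.\<close>

lemma language_at_0:
  assumes "w \<in> language X" obtains x where "x \<in> X" "factor x 0 (length w) = w"
proof -
  obtain x i n where x: "x \<in> X" and w: "w = factor x i n"
    using assms by (auto simp: language_eq)
  have shift_back: "\<exists>y\<in>X. \<forall>k. y k = x (k - int m)" for m
  proof (induction m)
    case 0
    then show ?case using x by auto
  next
    case (Suc m)
    then obtain y where y: "y \<in> X" "\<forall>k. y k = x (k - int m)" by blast
    then obtain z where z: "z \<in> X" "y = shift z" using shift_image by blast
    have "z k = x (k - int (Suc m))" for k
    proof -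
      have "z k = y (k - 1)" by (simp add: z shift_def)
      then show ?thesis using y(2) by (simp add: algebra_simps)
    qed
    then show ?case using z(1) by blast
  qed
  show ?thesis
  proof (cases "0 \<le> i")
    case True
    then show ?thesis
      using that[OF funpow_shift_in[OF x, of "nat i"]] by (simp add: w factor_funpow_shift)
  next
    case False
    obtain y where y: "y \<in> X" "\<forall>k. y k = x (k - int (nat (- i)))" using shift_back by blast
    have "factor y 0 (length w) = w"
      using False by (simp add: w factor_eq_iff y(2) add.commute)
    then show ?thesis using that y(1) by blast
  qed
qed

text \<open>The points of X that avoid u form a closed invariant set. Some point of X contains u, so
  this set is proper and minimality makes it empty.\<close>

lemma occurs:
  assumes "u \<in> language X" "x \<in> X"
  obtains i where "factor x i (length u) = u"
proof -
  let ?C = "\<lambda>i. {y. range y \<subseteq> A \<and> factor y i (length u) = u}"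
  define Y where "Y = X - (\<Union>i. ?C i)"
  have Y_iff: "y \<in> Y \<longleftrightarrow> y \<in> X \<and> (\<forall>i. factor y i (length u) \<noteq> u)" for y
    using range_subset by (auto simp: Y_def)
  have "openin (full_shift A) (\<Union>i. ?C i)"
    by (intro openin_Union) (auto intro: openin_cylinder)
  then have "closedin (full_shift A) Y"
    unfolding Y_def by (intro closedin_diff closedin)
  moreover have "shift ` Y = Y"
  proof -
    have *: "shift z \<in> Y \<longleftrightarrow> z \<in> Y" if "z \<in> X" for z
    proof -
      have "factor (shift z) i (length u) = factor z (i + 1) (length u)" for i
        using factor_funpow_shift[of 1 z i] by simp
      \<comment> \<open>Positions range over all integers, so reindexing by one loses nothing; this
        gives invariance in both directions.\<close>
      moreover have "(\<forall>i. factor z (i + 1) (length u) \<noteq> u) \<longleftrightarrow> (\<forall>i. factor z i (length u) \<noteq> u)"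
        by (metis diff_add_cancel)
      ultimately show ?thesis using that shift_in by (simp add: Y_iff)
    qed
    have "Y \<subseteq> X" by (auto simp: Y_def)
    show ?thesis
    proof (intro equalityI subsetI)
      fix y assume "y \<in> shift ` Y" then show "y \<in> Y" using * \<open>Y \<subseteq> X\<close> by blast
    next
      fix y assume "y \<in> Y"
      then obtain z where "z \<in> X" "y = shift z" using shift_image \<open>Y \<subseteq> X\<close> by blast
      then show "y \<in> shift ` Y" using * \<open>y \<in> Y\<close> by blast
    qed
  qed
  moreover have "Y \<subset> X"
  proof -
    obtain z where "z \<in> X" "factor z 0 (length u) = u" using language_at_0[OF assms(1)] .
    then have "z \<in> X" "z \<notin> Y" by (auto simp: Y_iff)
    then show ?thesis by (auto simp: Y_def)
  qed
  ultimately have "Y = {}" using minimal unfolding minimal_shift_space_def by blast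
  then show ?thesis using Y_iff assms(2) that by blast
qed

text \<open>The occurrence given by \<open>occurs\<close> may lie to the left. Compactness bounds
  its distance from the origin uniformly over X, so applying the bound to a shifted point forces it
  to the right.\<close>

lemma occurs_right:
  assumes u: "u \<in> language X" and x: "x \<in> X"
  obtains k where "l \<le> k" "factor x (int k) (length u) = u"
proof -
  let ?C = "\<lambda>i. {y. range y \<subseteq> A \<and> factor y i (length u) = u}"
  have "X \<subseteq> (\<Union>i. ?C i)"
  proof
    fix y assume y: "y \<in> X"
    then obtain i where "factor y i (length u) = u" using occurs[OF u] by blast
    then show "y \<in> (\<Union>i. ?C i)" using range_subset[OF y] by auto
  qed
  then have "\<exists>\<F>. finite \<F> \<and> \<F> \<subseteq> range ?C \<and> X \<subseteq> \<Union> \<F>"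
    by (intro compactinD[OF compactin]) (auto intro: openin_cylinder)
  then obtain I where I: "finite I" "X \<subseteq> (\<Union>i\<in>I. ?C i)"
    by (metis (no_types, lifting) finite_subset_image)
  obtain M where M: "\<forall>k\<in>(\<lambda>i. nat \<bar>i\<bar>) ` I. k \<le> M"
    using I(1) finite_nat_set_iff_bounded_le by (metis finite_imageI)
  \<comment> \<open>Occurrences are at distance at most \<open>M\<close> from the origin, so looking from position \<open>l + M\<close>
    one finds an occurrence to the right of \<open>l\<close>.\<close>
  obtain i where i: "i \<in> I" "factor ((shift ^^ (l + M)) x) i (length u) = u"
    using I(2) funpow_shift_in[OF x, of "l + M"] by blast
  have "nat \<bar>i\<bar> \<le> M" using M i(1) by auto
  then have "l \<le> nat (i + int (l + M))" "int (nat (i + int (l + M))) = i + int (l + M)"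
    by linarith+
  then show ?thesis using that i(2) by (metis factor_funpow_shift)
qed

text \<open>This excludes an empty image under \<open>\<phi>\<close>: the conditions ask for
  equality with {1}, not inclusion. The word up to the least positive occurrence is a return
  word.\<close>

lemma return_words_nonempty:
  assumes "u \<in> language X" shows "return_words X u \<noteq> {}"
proof -
  obtain x where x: "x \<in> X" "factor x 0 (length u) = u" using language_at_0[OF assms] .
  let ?P = "\<lambda>j. 0 < j \<and> factor x (int j) (length u) = u"
  obtain k where "Suc 0 \<le> k" "factor x (int k) (length u) = u"
    using occurs_right[OF assms x(1)] .
  then have "?P k" by simp
  then have "?P (Least ?P)" by (rule LeastI)
  moreover have "\<not> ?P j" if "j < Least ?P" for j using not_less_Least[OF that] .
  ultimately have "factor x 0 (Least ?P) \<in> return_words X u"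
    by (intro first_return_in_return_words x) auto
  then show ?thesis by blast
qed

lemma return_words_in_lists:
  assumes "r \<in> return_words X u" shows "r \<in> lists A" "u \<in> lists A"
proof -
  obtain x i n where "x \<in> X" "r @ u = factor x i n"
    using assms by (auto simp: return_words_def language_eq)
  then have "r @ u \<in> lists A" using factor_in_lists range_subset by metis
  then show "r \<in> lists A" "u \<in> lists A" by auto
qed

section \<open>Locally constant maps\<close>

text \<open>Continuity into a discrete space gives each point a window that determines
  \<open>\<alpha>\<close> near it. Finitely many of these cylinders cover X, and the largest radius
  serves all points.\<close>

lemma uniform_window:
  assumes "continuous_map (subtopology (full_shift A) X) (discrete_topology B) \<alpha>"
  obtains n where "\<And>x y. \<lbrakk>x \<in> X; y \<in> X;
    factor x (- int n) (2 * n) = factor y (- int n) (2 * n)\<rbrakk> \<Longrightarrow> \<alpha> x = \<alpha> y"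
proof -
  let ?w = "\<lambda>n x. factor x (- int n) (2 * n)"
  let ?C = "\<lambda>n x. {y. range y \<subseteq> A \<and> ?w n y = ?w n x}"
  have open_C: "openin (full_shift A) (?C n x)" for n x
    using openin_cylinder[of A "- int n" "?w n x"] by simp
  have "\<exists>n. \<forall>y\<in>X. ?w n y = ?w n x \<longrightarrow> \<alpha> y = \<alpha> x" if x: "x \<in> X" for x
  proof -
    have "\<alpha> x \<in> B"
      using continuous_map_image_subset_topspace[OF assms] x range_subset
      by (auto simp: topspace_full_shift)
    then have "openin (subtopology (full_shift A) X)
        {y \<in> topspace (subtopology (full_shift A) X). \<alpha> y \<in> {\<alpha> x}}"
      by (intro openin_continuous_map_preimage[OF assms]) simp
    then obtain U where U: "openin (full_shift A) U"
        "{y \<in> topspace (subtopology (full_shift A) X). \<alpha> y \<in> {\<alpha> x}} = U \<inter> X"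
      unfolding openin_subtopology by blast
    have *: "y \<in> U \<longleftrightarrow> \<alpha> y = \<alpha> x" if "y \<in> X" for y
    proof -
      have "y \<in> topspace (subtopology (full_shift A) X)"
        using that range_subset by (auto simp: topspace_full_shift)
      then show ?thesis using U(2) that by blast
    qed
    obtain n where "\<And>y. range y \<subseteq> A \<Longrightarrow> ?w n y = ?w n x \<Longrightarrow> y \<in> U"
      using openin_full_shift_window[OF U(1)] *[OF x] by metis
    then show ?thesis using * range_subset by blast
  qed
  then obtain m where m: "\<And>x y. \<lbrakk>x \<in> X; y \<in> X; ?w (m x) y = ?w (m x) x\<rbrakk> \<Longrightarrow> \<alpha> y = \<alpha> x"
    by metis
  have "X \<subseteq> (\<Union>x\<in>X. ?C (m x) x)" using range_subset by blast
  then have "\<exists>\<F>. finite \<F> \<and> \<F> \<subseteq> (\<lambda>x. ?C (m x) x) ` X \<and> X \<subseteq> \<Union> \<F>"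
    by (intro compactinD[OF compactin]) (auto intro: open_C)
  then obtain F where F: "finite F" "F \<subseteq> X" "X \<subseteq> (\<Union>x\<in>F. ?C (m x) x)"
    by (metis (no_types, lifting) finite_subset_image)
  obtain n where n: "\<forall>k\<in>m ` F. k \<le> n"
    using F(1) finite_nat_set_iff_bounded_le by (metis finite_imageI)
  \<comment> \<open>Windows are centred at the origin, so the smaller one starts n - k letters into
    the larger one.\<close>
  have restrict: "?w k x = ?w k y" if "?w n x = ?w n y" "k \<le> n" for x y k
  proof -
    have "take (2 * k) (drop (n - k) (?w n z)) = ?w k z" for z
      using that(2) by (subst take_drop_factor) (auto simp: of_nat_diff)
    then show ?thesis using that(1) by metis
  qed
  show ?thesis
  proof (rule that[of n])
    fix x y assume xy: "x \<in> X" "y \<in> X" "?w n x = ?w n y"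
    \<comment> \<open>The centre z of a cylinder containing x also has y in its cylinder, so both
      values are compared with \<open>\<alpha> z\<close>.\<close>
    obtain z where z: "z \<in> F" "?w (m z) x = ?w (m z) z" using F(3) xy(1) by blast
    have "?w (m z) y = ?w (m z) x" using restrict[OF xy(3)] n z(1) by simp
    then have "\<alpha> x = \<alpha> z" "\<alpha> y = \<alpha> z" using m[of z] z F(2) xy by auto
    then show "\<alpha> x = \<alpha> y" by simp
  qed
qed

text \<open>Each point has a cylinder neighbourhood on which \<open>\<alpha>\<close> is constant, so
  all preimages are open. The window starts at 0 and its length may depend on the point, which suits
  maps defined by a first occurrence.\<close>

lemma continuous_map_if_locally_determined:
  assumes "\<And>x. x \<in> X \<Longrightarrow> \<alpha> x \<in> B"
    and local: "\<And>x. x \<in> X \<Longrightarrow> \<exists>n. \<forall>y\<in>X. factor y 0 n = factor x 0 n \<longrightarrow> \<alpha> y = \<alpha> x"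
  shows "continuous_map (subtopology (full_shift A) X) (discrete_topology B) \<alpha>"
proof -
  have top: "topspace (subtopology (full_shift A) X) = X"
    using range_subset by (auto simp: topspace_full_shift)
  have "openin (subtopology (full_shift A) X) {x \<in> X. \<alpha> x \<in> U}" for U
  proof (subst openin_subopen, intro ballI)
    fix x assume "x \<in> {x \<in> X. \<alpha> x \<in> U}"
    then have x: "x \<in> X" "\<alpha> x \<in> U" by auto
    obtain n where n: "\<forall>y\<in>X. factor y 0 n = factor x 0 n \<longrightarrow> \<alpha> y = \<alpha> x" using local[OF x(1)] ..
    let ?C = "{y. range y \<subseteq> A \<and> factor y 0 n = factor x 0 n} \<inter> X"
    have "openin (full_shift A) {y. range y \<subseteq> A \<and> factor y 0 n = factor x 0 n}"
      using openin_cylinder[of A 0 "factor x 0 n"] by simp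
    then have "openin (subtopology (full_shift A) X) ?C"
      by (rule openin_subtopology_Int)
    moreover have "x \<in> ?C" using x range_subset by blast
    moreover have "?C \<subseteq> {x \<in> X. \<alpha> x \<in> U}"
    proof
      fix y assume "y \<in> ?C"
      then have "y \<in> X" "\<alpha> y = \<alpha> x" using n by blast+
      then show "y \<in> {x \<in> X. \<alpha> x \<in> U}" using x(2) by simp
    qed
    ultimately show "\<exists>T. openin (subtopology (full_shift A) X) T \<and> x \<in> T \<and> T \<subseteq> {x \<in> X. \<alpha> x \<in> U}"
      by blast
  qed
  then show ?thesis using assms(1) unfolding continuous_map_def top by simp
qed

end

section \<open>Cobounding maps and return words\<close>

locale minimal_shift_morphism = minimal_shift A X + group G
  for A :: "'a set" and X and G :: "('g, 'm) monoid_scheme" (structure) +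
  fixes \<phi> :: "'a list \<Rightarrow> 'g"
  assumes hom: "\<phi> \<in> hom (word_monoid A) G"
begin

lemma phi_closed: "w \<in> lists A \<Longrightarrow> \<phi> w \<in> carrier G"
  using hom by (auto simp: hom_def word_monoid_def)

lemma phi_append: "\<lbrakk>v \<in> lists A; w \<in> lists A\<rbrakk> \<Longrightarrow> \<phi> (v @ w) = \<phi> v \<otimes> \<phi> w"
  using hom_mult[OF hom, of v w] by (simp add: word_monoid_def)

lemma phi_Nil: "\<phi> [] = \<one>"
  by (rule hom_word_monoid_Nil[OF is_group hom])

lemma factor_lists: "x \<in> X \<Longrightarrow> factor x i n \<in> lists A"
  by (intro factor_in_lists range_subset)

text \<open>The cobounding equation telescopes along the orbit: passing from the n-th to the next
  shift contributes the letter x n on the right.\<close>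

lemma cobounding_map_funpow_shift:
  assumes cob: "cobounding_map A X G \<phi> \<alpha>" and x: "x \<in> X"
  shows "\<alpha> ((shift ^^ n) x) = \<alpha> x \<otimes> \<phi> (factor x 0 n)"
proof -
  have "continuous_map (subtopology (full_shift A) X) (discrete_topology (carrier G)) \<alpha>"
    using cob by (simp add: cobounding_map_def)
  from continuous_map_image_subset_topspace[OF this] have \<alpha>: "\<alpha> x \<in> carrier G"
    using x range_subset[OF x] by (auto simp: topspace_full_shift)
  show ?thesis
  proof (induction n)
    case 0
    then show ?case using \<alpha> by (simp add: phi_Nil)
  next
    case (Suc n)
    have letter: "[x (int n)] \<in> lists A" using range_subset[OF x] by auto
    have "\<alpha> ((shift ^^ Suc n) x) = \<alpha> ((shift ^^ n) x) \<otimes> \<phi> [x (int n)]"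
      using cob funpow_shift_in[OF x, of n] by (simp add: cobounding_map_def funpow_shift)
    also have "\<dots> = \<alpha> x \<otimes> \<phi> (factor x 0 n @ [x (int n)])"
      using \<alpha> letter factor_lists[OF x] by (simp only: Suc phi_append m_assoc phi_closed)
    finally show ?case by (simp add: factor_Suc_right)
  qed
qed

section \<open>From a cobounding map to trivial return words\<close>

lemma return_words_trivial_if_cobounding_map:
  assumes cob: "cobounding_map A X G \<phi> \<alpha>"
  obtains N where "\<And>u. \<lbrakk>u \<in> language X; N \<le> length u\<rbrakk> \<Longrightarrow> \<phi> ` return_words X u = {\<one>}"
proof -
  have cont: "continuous_map (subtopology (full_shift A) X) (discrete_topology (carrier G)) \<alpha>"
    using cob by (simp add: cobounding_map_def)
  then obtain n where n: "\<And>x y. \<lbrakk>x \<in> X; y \<in> X;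
      factor x (- int n) (2 * n) = factor y (- int n) (2 * n)\<rbrakk> \<Longrightarrow> \<alpha> x = \<alpha> y"
    using uniform_window by blast
  show ?thesis
  proof (rule that[of "2 * n"])
    fix u assume u: "u \<in> language X" "2 * n \<le> length u"
    have "\<phi> r = \<one>" if r: "r \<in> return_words X u" for r
    proof -
      have "r @ u \<in> language X" using r by (simp add: return_words_def)
      then obtain x where x: "x \<in> X" "factor x 0 (length (r @ u)) = r @ u"
        using language_at_0 by blast
      let ?l = "length r"
      have "factor x 0 ?l @ factor x (int ?l) (length u) = r @ u"
        using x(2) factor_add[of x 0 ?l "length u"] by simp
      then have r_eq: "factor x 0 ?l = r" and u_eq: "factor x (int ?l) (length u) = u" by auto
      obtain v where "r @ u = u @ v"
        using r by (auto simp: return_words_def prefix_def)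
      then have "take (length u) (r @ u) = u" by simp
      then have u_eq0: "factor x 0 (length u) = u"
        using take_drop_factor[of 0 "length u" "length (r @ u)" x 0] x(2) by simp
      have pre: "factor x (int ?l) k = factor x 0 k" if "k \<le> length u" for k
        using that take_drop_factor[of 0 k "length u" x "int ?l"]
          take_drop_factor[of 0 k "length u" x 0] u_eq u_eq0 by simp
      \<comment> \<open>The extra shift by n moves the windows onto the first 2n letters of the
        occurrences of u at |r| and at 0, where they agree.\<close>
      have "\<alpha> ((shift ^^ (?l + n)) x) = \<alpha> ((shift ^^ n) x)"
        using u(2) by (intro n funpow_shift_in x) (simp add: factor_funpow_shift pre)
      \<comment> \<open>After r the point x repeats its own first n letters. Once both sides of the
        previous equality are telescoped, \<open>\<alpha> x\<close> cancels on the left and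
        \<open>\<phi> (factor x 0 n)\<close> on the right.\<close>
      moreover have "\<phi> (factor x 0 (?l + n)) = \<phi> r \<otimes> \<phi> (factor x 0 n)"
        using u(2) by (simp add: factor_add r_eq pre phi_append factor_lists x
            return_words_in_lists[OF r])
      moreover have "\<alpha> x \<in> carrier G"
        using continuous_map_image_subset_topspace[OF cont] x(1) range_subset[OF x(1)]
        by (auto simp: topspace_full_shift)
      moreover have "\<phi> r \<in> carrier G" "\<phi> (factor x 0 n) \<in> carrier G"
        by (simp_all add: phi_closed return_words_in_lists[OF r] factor_lists x)
      ultimately show ?thesis
        using cobounding_map_funpow_shift[OF cob x(1)] by simp
    qed
    then show "\<phi> ` return_words X u = {\<one>}" using return_words_nonempty[OF u(1)] by auto
  qed
qed

section \<open>From trivial return words to a cobounding map\<close>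

lemma cobounding_map_if_return_words_trivial:
  assumes u: "u \<in> language X" and trivial: "\<phi> ` return_words X u = {\<one>}"
  obtains \<alpha> where "cobounding_map A X G \<phi> \<alpha>"
proof -
  let ?occ = "\<lambda>x k. factor x (int k) (length u) = u"
  define first where "first x = (LEAST k. ?occ x k)" for x
  \<comment> \<open>The inverse turns removal of the first letter of a word into multiplication on
    the right, as the cobounding equation requires.\<close>
  define \<alpha> where "\<alpha> x = inv \<phi> (factor x 0 (first x))" for x
  have first: "?occ x (first x)" if x: "x \<in> X" for x
  proof -
    obtain k where "?occ x k" using occurs_right[OF u x, of 0] by blast
    then show ?thesis unfolding first_def by (rule LeastI)
  qed
  have not_before: "\<not> ?occ x k" if "k < first x" for x k
    using not_less_Least[of k "?occ x"] that by (simp add: first_def)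
  have first_eqI: "first x = k" if "?occ x k" "\<And>j. j < k \<Longrightarrow> \<not> ?occ x j" for x k
    unfolding first_def by (rule Least_equality) (use that not_less in blast)+
  have occ_shift: "?occ (shift x) k \<longleftrightarrow> ?occ x (Suc k)" for x k
    using factor_funpow_shift[of 1 x "int k" "length u"] by (simp add: add.commute)
  \<comment> \<open>Here \<open>Suc (first (shift x))\<close> is the first positive position of u in
    x. It remains to compare the word up to there with the word up to \<open>first x\<close>: they
    coincide unless \<open>first x\<close> is 0.\<close>
  have step: "\<alpha> (shift x) = inv \<phi> (factor x 0 (Suc (first (shift x)))) \<otimes> \<phi> [x 0]"
    if x: "x \<in> X" for x
  proof -
    let ?w = "factor (shift x) 0 (first (shift x))"
    have w: "?w \<in> lists A" using x by (intro factor_lists shift_in)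
    have x0: "[x 0] \<in> lists A" using range_subset[OF x] by auto
    have "factor x 0 (Suc (first (shift x))) = [x 0] @ ?w"
      using factor_funpow_shift[of 1 x 0] by (simp add: factor_Suc)
    then have "\<phi> (factor x 0 (Suc (first (shift x)))) = \<phi> [x 0] \<otimes> \<phi> ?w"
      using phi_append[OF x0 w] by simp
    then show ?thesis
      using phi_closed[OF w] phi_closed[OF x0] by (simp add: \<alpha>_def inv_mult_group m_assoc)
  qed
  have "\<alpha> (shift x) = \<alpha> x \<otimes> \<phi> [x 0]" if x: "x \<in> X" for x
  proof (cases "first x")
    case 0
    have occ0: "?occ x 0" using first[OF x] 0 by simp
    have "factor x 0 (Suc (first (shift x))) \<in> return_words X u"
    proof (rule first_return_in_return_words[OF x])
      show "factor x (0 + int (Suc (first (shift x)))) (length u) = u"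
        using first[OF shift_in[OF x]] occ_shift by simp
      show "factor x (0 + int k) (length u) \<noteq> u" if "0 < k" "k < Suc (first (shift x))" for k
        using that not_before[of "k - 1" "shift x"] occ_shift[of x "k - 1"] by simp
    qed (use occ0 in simp_all)
    then have "\<phi> (factor x 0 (Suc (first (shift x)))) = \<one>" using trivial by auto
    then show ?thesis using step[OF x] 0 by (simp add: \<alpha>_def phi_Nil)
  next
    case (Suc k)
    have "first (shift x) = k"
    proof (rule first_eqI)
      show "?occ (shift x) k" using first[OF x] Suc occ_shift[of x k] by simp
      show "\<not> ?occ (shift x) j" if "j < k" for j
        using that Suc not_before[of "Suc j" x] occ_shift[of x j] by simp
    qed
    then show ?thesis using step[OF x] Suc by (simp add: \<alpha>_def)
  qed
  moreover have "continuous_map (subtopology (full_shift A) X) (discrete_topology (carrier G)) \<alpha>"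
  proof (rule continuous_map_if_locally_determined)
    show "\<alpha> x \<in> carrier G" if "x \<in> X" for x
      using that by (simp add: \<alpha>_def phi_closed factor_lists)
  next
    fix x assume x: "x \<in> X"
    \<comment> \<open>This window contains the first occurrence of u and every earlier candidate in
      full, so agreement on it transfers both the occurrence and the absence of earlier
      ones.\<close>
    let ?n = "first x + length u"
    have "\<alpha> y = \<alpha> x" if "y \<in> X" and eq: "factor y 0 ?n = factor x 0 ?n" for y
    proof -
      have same: "factor y (int k) m = factor x (int k) m" if "k + m \<le> ?n" for k m
        using take_drop_factor[OF that, of y 0] take_drop_factor[OF that, of x 0] eq by simp
      have "first y = first x"
        by (rule first_eqI) (use same first[OF x] not_before[of _ x] in auto)
      then show ?thesis using same[of 0 "first x"] by (simp add: \<alpha>_def)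
    qed
    then show "\<exists>n. \<forall>y\<in>X. factor y 0 n = factor x 0 n \<longrightarrow> \<alpha> y = \<alpha> x" by blast
  qed
  ultimately have "cobounding_map A X G \<phi> \<alpha>" by (simp add: cobounding_map_def)
  then show ?thesis by (rule that)
qed

end

theorem corollary7p11:
  fixes A :: "'a set" and X :: "(int \<Rightarrow> 'a) set"
    and G :: "('g, 'm) monoid_scheme" and \<phi> :: "'a list \<Rightarrow> 'g"
  assumes "finite A"
    and "minimal_shift_space A X"
    and "group G"
    and "finite (carrier G)"
    and "\<phi> \<in> epi (word_monoid A) G"
  shows "((\<exists>\<alpha>. cobounding_map A X G \<phi> \<alpha>) \<longleftrightarrow>
          (\<exists>N. \<forall>u\<in>language X. N \<le> length u \<longrightarrow> \<phi> ` return_words X u = {\<one>\<^bsub>G\<^esub>})) \<and>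
         ((\<exists>N. \<forall>u\<in>language X. N \<le> length u \<longrightarrow> \<phi> ` return_words X u = {\<one>\<^bsub>G\<^esub>}) \<longleftrightarrow>
          (\<exists>u\<in>language X. \<phi> ` return_words X u = {\<one>\<^bsub>G\<^esub>}))"
    (is "(?i \<longleftrightarrow> ?ii) \<and> (?ii \<longleftrightarrow> ?iii)")
proof -
  have "\<phi> \<in> hom (word_monoid A) G" using assms(5) by (simp add: epi_def)
  then interpret minimal_shift_morphism A X G \<phi>
    using assms by (simp add: minimal_shift_morphism_def minimal_shift_def
        minimal_shift_morphism_axioms_def)
  have "?ii" if "?i" using that return_words_trivial_if_cobounding_map by metis
  moreover have "?iii" if ii: "?ii"
  proof -
    obtain N where N: "\<forall>u\<in>language X. N \<le> length u \<longrightarrow> \<phi> ` return_words X u = {\<one>\<^bsub>G\<^esub>}"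
      using ii ..
    \<comment> \<open>Any point of X supplies a word of length exactly N, so the condition on long
      words is not vacuous.\<close>
    obtain x where "x \<in> X" using nonempty by blast
    then have "factor x 0 N \<in> language X" unfolding language_eq by blast
    then show ?thesis using N by (metis length_factor order_refl)
  qed
  moreover have "?i" if "?iii" using that cobounding_map_if_return_words_trivial by metis
  ultimately show ?thesis by blast
qed

end
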